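(* Let $(C,T)=(C,T_1,T_2,\ldots)$ be a sequence of non-negative random variables, let $\mathfrak{F}_{\Sigma}(C,T)$ be the set of fixed points of the associated inhomogeneous smoothing transform, and let $W^*=\sum_{v\in\mathbb{V}}L(v)C(v)\in[0,\infty]$ be defined through the weighted branching model with basic sequence $(C,T)$. Then $\mathfrak{F}_{\Sigma}(C,T)\neq\emptyset$ if and only if $W^*<\infty$ almost surely.
   Context: Fixed points: $\mathfrak{F}_{\Sigma}(C,T)$ is the set of probability distributions $P$ on $[0,\infty)$ such that, if $X,X_1,X_2,\ldots$ are i.i.d. with distribution $P$ and $(X_i)_{i\ge1}$ is independent of $(C,T)$, then $X\stackrel{d}{=}C+\sum_{i\ge1}T_iX_i$ (equality in distribution). Weighted branching model: $\mathbb{V}=\bigcup_{n\ge0}\mathbb{N}^n$ with $\mathbb{N}=\{1,2,\ldots\}$ and $\mathbb{N}^0=\{\varnothing\}$; $|v|=n$ iff $v\in\mathbb{N}^n$; $vi$ denotes $v$ with the entry $i$ appended. Let $(C(v),T(v))_{v\in\mathbb{V}}$, with $T(v)=(T_1(v),T_2(v),\ldots)$, be a family of i.i.d. copies of $(C,T)$ with $(C(\varnothing),T(\varnothing))=(C,T)$. Put $L(\varnothing)=1$ and $L(vi)=L(v)T_i(v)$ for $v\in\mathbb{V}$, $i\in\mathbb{N}$. *)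

theory Defs
  imports "HOL-Probability.Probability"
begin

text \<open>Conventions: the sequence \<open>T\<^sub>1, T\<^sub>2, \<dots>\<close> is indexed from 0, i.e. \<open>T 0, T 1, \<dots>\<close>.  Accordingly the
  vertices of the Ulam--Harris tree are all finite lists over \<^typ>\<open>nat\<close>; \<open>[]\<close> is the root
  and \<open>v @ [i]\<close> is the \<open>i\<close>-th child of \<open>v\<close>.\<close>

abbreviation basic_space :: "(real \<times> (nat \<Rightarrow> real)) measure" where
  "basic_space \<equiv> borel \<Otimes>\<^sub>M (\<Pi>\<^sub>M i\<in>UNIV. borel)"

definition basic_sequence :: "('a \<Rightarrow> real) \<Rightarrow> (nat \<Rightarrow> 'a \<Rightarrow> real) \<Rightarrow> 'a \<Rightarrow> real \<times> (nat \<Rightarrow> real)" where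
  "basic_sequence C T = (\<lambda>\<omega>. (C \<omega>, \<lambda>i. T i \<omega>))"

definition smoothing_sum :: "real \<times> (nat \<Rightarrow> real) \<Rightarrow> (nat \<Rightarrow> real) \<Rightarrow> ennreal" where
  "smoothing_sum ct x = ennreal (fst ct) + (\<Sum>i. ennreal (snd ct i * x i))"

text \<open>\<open>smoothing_transform Q P\<close> is the law on \<open>[0,\<infinity>]\<close> of \<open>C + (\<Sum>i. T\<^sub>i X\<^sub>i)\<close>, where \<open>(C,T)\<close> has law \<open>Q\<close>,
  the \<open>X\<^sub>i\<close> are i.i.d. with law \<open>P\<close>, and \<open>(X\<^sub>i)\<close> is independent of \<open>(C,T)\<close>.  It is taken on
  the canonical space; \<open>distr_smoothing_sum\<close> below shows that every other
  realization of these random variables gives the same law.\<close>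

definition smoothing_transform ::
    "(real \<times> (nat \<Rightarrow> real)) measure \<Rightarrow> real measure \<Rightarrow> ennreal measure" where
  "smoothing_transform Q P =
     distr (Q \<Otimes>\<^sub>M (\<Pi>\<^sub>M i\<in>UNIV. P)) borel (\<lambda>(ct, x). smoothing_sum ct x)"

text \<open>The law of \<open>X\<close> is pushed to \<open>[0,\<infinity>]\<close> along the inclusion, since the right-hand side of the
  fixed-point equation may a priori be infinite.\<close>

definition smoothing_fixed_points :: "(real \<times> (nat \<Rightarrow> real)) measure \<Rightarrow> real measure set" where
  "smoothing_fixed_points Q =
     {P. real_distribution P \<and> (AE x in P. 0 \<le> x) \<and>
         distr P borel ennreal = smoothing_transform Q P}"

function branch_weight :: "(nat list \<Rightarrow> nat \<Rightarrow> 'a \<Rightarrow> real) \<Rightarrow> nat list \<Rightarrow> 'a \<Rightarrow> real" where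
  "branch_weight T v \<omega> =
     (if v = [] then 1 else branch_weight T (butlast v) \<omega> * T (butlast v) (last v) \<omega>)"
  by pat_completeness auto
termination
  by (relation "Wellfounded.measure (\<lambda>(T, v, \<omega>). length v)") auto

declare branch_weight.simps [simp del]

lemma branch_weight_Nil [simp]: "branch_weight T [] \<omega> = 1"
  by (simp add: branch_weight.simps)

lemma branch_weight_snoc [simp]:
  "branch_weight T (v @ [i]) \<omega> = branch_weight T v \<omega> * T v i \<omega>"
  by (subst branch_weight.simps) simp

definition W_star :: "(nat list \<Rightarrow> 'a \<Rightarrow> real) \<Rightarrow> (nat list \<Rightarrow> nat \<Rightarrow> 'a \<Rightarrow> real) \<Rightarrow> 'a \<Rightarrow> ennreal" where
  "W_star C T \<omega> = (\<Sum>\<^sub>\<infinity>v\<in>UNIV. ennreal (branch_weight T v \<omega> * C v \<omega>))"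

lemma measurable_smoothing_sum:
  "(\<lambda>(ct, x). smoothing_sum ct x) \<in> borel_measurable (basic_space \<Otimes>\<^sub>M (\<Pi>\<^sub>M i\<in>UNIV. borel))"
  unfolding smoothing_sum_def case_prod_beta by measurable

lemma distr_smoothing_sum:
  fixes N :: "'b measure" and Y :: "'b \<Rightarrow> real \<times> (nat \<Rightarrow> real)" and X :: "nat \<Rightarrow> 'b \<Rightarrow> real"
  assumes N: "prob_space N"
    and Y: "Y \<in> measurable N basic_space" "distr N basic_space Y = Q"
    and iid: "prob_space.indep_vars N (\<lambda>_. borel) X UNIV" "\<And>i. distr N borel (X i) = P"
    and indep: "prob_space.indep_set N {Y -` A \<inter> space N |A. A \<in> sets basic_space}
       {(\<lambda>\<omega> i. X i \<omega>) -` B \<inter> space N |B. B \<in> sets (\<Pi>\<^sub>M i\<in>UNIV. borel)}"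
  shows "distr N borel (\<lambda>\<omega>. smoothing_sum (Y \<omega>) (\<lambda>i. X i \<omega>)) = smoothing_transform Q P"
proof -
  interpret prob_space N by fact
  let ?B = "\<Pi>\<^sub>M i\<in>(UNIV :: nat set). borel :: real measure"
  let ?X = "\<lambda>\<omega> i. X i \<omega>"
  have X: "X i \<in> borel_measurable N" for i
    using iid(1) by (auto simp: indep_vars_def)
  have mX: "?X \<in> measurable N ?B"
    using X by (intro measurable_PiM_single') auto
  have dX: "distr N ?B ?X = (\<Pi>\<^sub>M i\<in>UNIV. P)"
    using iid X by (subst (asm) indep_vars_iff_distr_eq_PiM) (auto simp: restrict_UNIV)
  interpret PY: prob_space "distr N basic_space Y" by (rule prob_space_distr) fact
  interpret PX: prob_space "distr N ?B ?X" by (rule prob_space_distr) fact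
  have "distr N basic_space Y \<Otimes>\<^sub>M distr N ?B ?X = distr N (basic_space \<Otimes>\<^sub>M ?B) (\<lambda>\<omega>. (Y \<omega>, ?X \<omega>))"
  proof (rule pair_measure_eqI)
    fix A B assume "A \<in> sets (distr N basic_space Y)" "B \<in> sets (distr N ?B ?X)"
    then have A: "A \<in> sets basic_space" and B: "B \<in> sets ?B" by simp_all
    have "prob ((Y -` A \<inter> space N) \<inter> (?X -` B \<inter> space N)) =
          prob (Y -` A \<inter> space N) * prob (?X -` B \<inter> space N)"
      using A B by (intro indep_setD[OF indep]) auto
    moreover have "(\<lambda>\<omega>. (Y \<omega>, ?X \<omega>)) -` (A \<times> B) \<inter> space N =
        (Y -` A \<inter> space N) \<inter> (?X -` B \<inter> space N)" by auto
    moreover have "A \<times> B \<in> sets (basic_space \<Otimes>\<^sub>M ?B)" using A B by (rule pair_measureI)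
    ultimately show "emeasure (distr N basic_space Y) A * emeasure (distr N ?B ?X) B =
        emeasure (distr N (basic_space \<Otimes>\<^sub>M ?B) (\<lambda>\<omega>. (Y \<omega>, ?X \<omega>))) (A \<times> B)"
      using Y(1) mX A B
      by (simp add: emeasure_distr measurable_Pair emeasure_eq_measure ennreal_mult)
  qed (auto intro: PY.sigma_finite_measure_axioms PX.sigma_finite_measure_axioms)
  then have "smoothing_transform Q P =
      distr (distr N (basic_space \<Otimes>\<^sub>M ?B) (\<lambda>\<omega>. (Y \<omega>, ?X \<omega>))) borel (\<lambda>(ct, x). smoothing_sum ct x)"
    by (simp add: smoothing_transform_def Y(2) dX)
  also have "\<dots> = distr N borel (\<lambda>\<omega>. smoothing_sum (Y \<omega>) (?X \<omega>))"
    using Y(1) mX by (subst distr_distr[OF measurable_smoothing_sum]) (auto simp: o_def)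
  finally show ?thesis ..
qed

end

theory Submission
  imports Defs
begin

text \<open>Everything rests on the branching property: if \<open>(Z\<^sub>v)\<close> is an i.i.d. family indexed by the tree, then the
  root mark and the families indexed by the subtrees of the root's children are independent, and every such family is a
  copy of the whole one. Hence \<open>W\<^sup>* = C + (\<Sum>i. T\<^sub>i W\<^sup>*\<^sub>i)\<close> with i.i.d. copies \<open>W\<^sup>*\<^sub>i\<close> of \<open>W\<^sup>*\<close>, so the law of \<open>W\<^sup>*\<close> is a
  fixed point as soon as \<open>W\<^sup>*\<close> is a.s. finite. Conversely, given a fixed point \<open>P\<close>, mark each vertex
  additionally with an independent \<open>X\<^sub>v\<close> of law \<open>P\<close>. Iterating the fixed-point equation shows that
  \<open>Y\<^sub>n = (\<Sum>|v|<n. L(v) C(v)) + (\<Sum>|v|=n. L(v) X\<^sub>v)\<close> has law \<open>P\<close> for every \<open>n\<close>. The truncated sums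
  \<open>(\<Sum>|v|<n. L(v) C(v))\<close> increase to \<open>W\<^sup>*\<close> and lie below \<open>Y\<^sub>n\<close>, so \<open>W\<^sup>*\<close> exceeds \<open>t\<close> with probability at
  most \<open>P{t<..}\<close>, which tends to \<open>0\<close>.\<close>

section \<open>Product laws and the decomposition of a marked tree at its root\<close>

text \<open>Coordinatewise images of i.i.d. coordinates are again i.i.d. This gives the joint law of
  a functional of the subtrees and, at the end of the converse direction, removes the additional
  marks.\<close>

lemma distr_PiM_map:
  assumes N: "prob_space N" and f: "f \<in> measurable N M'"
  shows "distr (\<Pi>\<^sub>M i\<in>UNIV. N) (\<Pi>\<^sub>M i\<in>UNIV. M') (\<lambda>x i. f (x i)) = (\<Pi>\<^sub>M i\<in>UNIV. distr N M' f)"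
proof -
  interpret N: product_prob_space "\<lambda>_. N" UNIV
    using N by (intro product_prob_spaceI)
  interpret D: product_prob_space "\<lambda>_. distr N M' f" UNIV
    using prob_space.prob_space_distr[OF N f] by (intro product_prob_spaceI)
  have mf: "(\<lambda>x i. f (x i)) \<in> measurable (\<Pi>\<^sub>M i\<in>UNIV. N) (\<Pi>\<^sub>M i\<in>(UNIV :: 'c set). M')"
    using f by (intro measurable_PiM_single') (auto simp: space_PiM PiE_iff intro: measurable_space[OF f])
  show ?thesis
  proof (rule D.PiM_eq)
    show "sets (distr (\<Pi>\<^sub>M i\<in>UNIV. N) (\<Pi>\<^sub>M i\<in>UNIV. M') (\<lambda>x i. f (x i))) = sets (\<Pi>\<^sub>M i\<in>UNIV. distr N M' f)"
      by (simp cong: sets_PiM_cong)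
  next
    fix J F assume J: "finite J" "J \<subseteq> (UNIV::'c set)" and F: "\<And>j. j \<in> J \<Longrightarrow> F j \<in> sets (distr N M' f)"
    let ?E = "prod_emb UNIV (\<lambda>_. distr N M' f) J (\<Pi>\<^sub>E j\<in>J. F j)"
    have E: "?E \<in> sets (\<Pi>\<^sub>M i\<in>UNIV. distr N M' f)"
      using J F by (intro sets_PiM_I) auto
    then have E': "?E \<in> sets (\<Pi>\<^sub>M i\<in>(UNIV::'c set). M')"
      by (simp cong: sets_PiM_cong)
    have "(\<lambda>x i. f (x i)) -` ?E \<inter> space (\<Pi>\<^sub>M i\<in>UNIV. N) =
        {x\<in>space (\<Pi>\<^sub>M i\<in>UNIV. N). \<forall>i\<in>J. x i \<in> f -` F i \<inter> space N}"
      using measurable_space[OF f] by (auto simp: prod_emb_def space_PiM PiE_iff)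
    then have "emeasure (distr (\<Pi>\<^sub>M i\<in>UNIV. N) (\<Pi>\<^sub>M i\<in>UNIV. M') (\<lambda>x i. f (x i))) ?E =
        (\<Prod>j\<in>J. emeasure N (f -` F j \<inter> space N))"
      using J F E' N.emeasure_PiM_Collect[of J "\<lambda>i. f -` F i \<inter> space N"]
      by (simp add: emeasure_distr[OF mf] measurable_sets[OF f])
    also have "\<dots> = (\<Prod>j\<in>J. emeasure (distr N M' f) (F j))"
      using F by (intro prod.cong) (auto simp: emeasure_distr[OF f])
    finally show "emeasure (distr (\<Pi>\<^sub>M i\<in>UNIV. N) (\<Pi>\<^sub>M i\<in>UNIV. M') (\<lambda>x i. f (x i))) ?E =
        (\<Prod>j\<in>J. emeasure (distr N M' f) (F j))" .
  qed
qed

text \<open>The inverse of cutting a tree at its root: \<open>w i\<close> becomes the subtree at the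
  child \<open>i\<close>. Words are split at their first letter, whereas
  \<open>branch_weight\<close> recurses on the last one.\<close>

definition join_tree :: "'b \<times> (nat \<Rightarrow> nat list \<Rightarrow> 'b) \<Rightarrow> nat list \<Rightarrow> 'b" where
  "join_tree = (\<lambda>(r, w) v. case v of [] \<Rightarrow> r | i # u \<Rightarrow> w i u)"

lemma join_tree_simps [simp]:
  "join_tree (r, w) [] = r" "join_tree (r, w) (i # u) = w i u"
  by (simp_all add: join_tree_def)

lemma measurable_join_tree [measurable]:
  "join_tree \<in> measurable (R \<Otimes>\<^sub>M (\<Pi>\<^sub>M i\<in>UNIV. \<Pi>\<^sub>M v\<in>UNIV. R)) (\<Pi>\<^sub>M v\<in>UNIV. R)"
proof (rule measurable_PiM_single')
  fix v :: "nat list"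
  show "(\<lambda>x. join_tree x v) \<in> measurable (R \<Otimes>\<^sub>M (\<Pi>\<^sub>M i\<in>UNIV. \<Pi>\<^sub>M v\<in>UNIV. R)) R"
  proof (cases v)
    case (Cons i u)
    have "(\<lambda>x. snd x i u) \<in> measurable (R \<Otimes>\<^sub>M (\<Pi>\<^sub>M i\<in>UNIV. \<Pi>\<^sub>M v\<in>UNIV. R)) R"
      by (rule measurable_compose[OF _ measurable_component_singleton[of u UNIV]]) simp_all
    then show ?thesis
      by (simp add: join_tree_def case_prod_beta Cons)
  qed (simp add: join_tree_def case_prod_beta)
qed (auto simp: join_tree_def space_pair_measure space_PiM PiE_iff Pi_iff split: list.split)

text \<open>The branching property as a statement about product measures. It is checked on
  cylinders: the preimage of one is a rectangle in the root mark and finitely many subtrees, so both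
  sides are the same finite product with its factors regrouped by first letter.\<close>

lemma distr_join_tree:
  assumes R: "prob_space R"
  shows "distr (R \<Otimes>\<^sub>M (\<Pi>\<^sub>M i\<in>UNIV. \<Pi>\<^sub>M v\<in>UNIV. R)) (\<Pi>\<^sub>M v\<in>UNIV. R) join_tree = (\<Pi>\<^sub>M v\<in>UNIV. R)"
proof -
  let ?O = "\<Pi>\<^sub>M v\<in>(UNIV :: nat list set). R"
  interpret R: prob_space R by fact
  interpret O: product_prob_space "\<lambda>_. R" "UNIV :: nat list set"
    using R by (intro product_prob_spaceI)
  interpret S: product_prob_space "\<lambda>_. ?O" "UNIV :: nat set"
    using O.prob_space_axioms by (intro product_prob_spaceI)
  show ?thesis
  proof (rule O.PiM_eq)
    fix J F assume J: "finite J" "J \<subseteq> (UNIV :: nat list set)" and F: "\<And>j. j \<in> J \<Longrightarrow> F j \<in> sets R"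
    \<comment> \<open>\<open>I\<close> collects the first letters of the nonempty words in
      \<open>J\<close>, and \<open>K i\<close> the remainders after the letter \<open>i\<close>;
      \<open>A\<close> and \<open>B i\<close> are the constraints on the root mark and on the
      \<open>i\<close>-th subtree.\<close>
    define I where "I = hd ` (J - {[]})"
    define K where "K i = {u. i # u \<in> J}" for i
    define A where "A = (if [] \<in> J then F [] else space R)"
    define B where "B i = {z \<in> space ?O. \<forall>u\<in>K i. z u \<in> F (i # u)}" for i
    have finI: "finite I" using J by (simp add: I_def)
    have finK: "finite (K i)" for i
      using finite_vimageI[OF J(1), of "Cons i"] by (simp add: K_def vimage_def)
    have KF: "u \<in> K i \<Longrightarrow> F (i # u) \<in> sets R" for u i
      using F by (simp add: K_def)
    have A: "A \<in> sets R" using F by (simp add: A_def)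
    have B: "B i \<in> sets ?O" for i
      unfolding B_def using KF finK by measurable
    have I: "i \<in> I" if "i # u \<in> J" for i u
      using image_eqI[of i hd "i # u" "J - {[]}"] that by (simp add: I_def)
    have J_eq: "J - {[]} = (\<lambda>(i, u). i # u) ` Sigma I K"
      using I by (auto simp: K_def I_def image_iff split: prod.splits) (metis list.collapse)
    let ?E = "prod_emb UNIV (\<lambda>_. R) J (\<Pi>\<^sub>E j\<in>J. F j)"
    have E: "?E \<in> sets ?O"
      using J F by (intro sets_PiM_I) auto
    have iff: "(\<forall>v\<in>J. join_tree (r, w) v \<in> F v) \<longleftrightarrow>
        ([] \<in> J \<longrightarrow> r \<in> F []) \<and> (\<forall>i\<in>I. \<forall>u\<in>K i. w i u \<in> F (i # u))" for r w
    proof -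
      have "(\<forall>v\<in>J. join_tree (r, w) v \<in> F v) \<longleftrightarrow> ([] \<in> J \<longrightarrow> r \<in> F []) \<and>
          (\<forall>v\<in>J - {[]}. join_tree (r, w) v \<in> F v)" by force
      also have "(\<forall>v\<in>J - {[]}. join_tree (r, w) v \<in> F v) \<longleftrightarrow>
          (\<forall>i\<in>I. \<forall>u\<in>K i. w i u \<in> F (i # u))"
        unfolding J_eq by auto
      finally show ?thesis .
    qed
    have sp: "join_tree x \<in> space ?O" if "x \<in> space (R \<Otimes>\<^sub>M (\<Pi>\<^sub>M i\<in>UNIV. ?O))" for x
      using measurable_space[OF measurable_join_tree that] .
    have "join_tree -` ?E \<inter> space (R \<Otimes>\<^sub>M (\<Pi>\<^sub>M i\<in>UNIV. ?O)) =
        A \<times> {w \<in> space (\<Pi>\<^sub>M i\<in>UNIV. ?O). \<forall>i\<in>I. w i \<in> B i}" (is "?L = ?R")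
    proof -
      have "x \<in> ?L \<longleftrightarrow> x \<in> ?R" for x
      proof (cases "x \<in> space (R \<Otimes>\<^sub>M (\<Pi>\<^sub>M i\<in>UNIV. ?O))")
        case True
        obtain r w where x: "x = (r, w)" by (cases x)
        have rw: "r \<in> space R" "w \<in> space (\<Pi>\<^sub>M i\<in>UNIV. ?O)" "\<And>i. w i \<in> space ?O"
          using True by (auto simp: x space_pair_measure space_PiM)
        have "x \<in> ?L \<longleftrightarrow> (\<forall>v\<in>J. join_tree (r, w) v \<in> F v)"
          using True sp[OF True] J by (auto simp: x prod_emb_def space_PiM PiE_iff)
        also have "\<dots> \<longleftrightarrow> x \<in> ?R"
          unfolding iff x B_def A_def using rw by auto
        finally show ?thesis .
      next
        case False
        then show ?thesis
          using sets.sets_into_space[OF A] by (auto simp: space_pair_measure)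
      qed
      then show ?thesis by blast
    qed
    then have "emeasure (distr (R \<Otimes>\<^sub>M (\<Pi>\<^sub>M i\<in>UNIV. ?O)) ?O join_tree) ?E =
        emeasure (R \<Otimes>\<^sub>M (\<Pi>\<^sub>M i\<in>UNIV. ?O)) (A \<times> {w \<in> space (\<Pi>\<^sub>M i\<in>UNIV. ?O). \<forall>i\<in>I. w i \<in> B i})"
      using E by (simp add: emeasure_distr)
    also have "\<dots> = emeasure R A * emeasure (\<Pi>\<^sub>M i\<in>UNIV. ?O) {w \<in> space (\<Pi>\<^sub>M i\<in>UNIV. ?O). \<forall>i\<in>I. w i \<in> B i}"
    proof (rule S.emeasure_pair_measure_Times[OF A])
      show "{w \<in> space (\<Pi>\<^sub>M i\<in>UNIV. ?O). \<forall>i\<in>I. w i \<in> B i} \<in> sets (\<Pi>\<^sub>M i\<in>UNIV. ?O)"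
        using finI B by measurable
    qed
    also have "\<dots> = emeasure R A * (\<Prod>i\<in>I. emeasure ?O (B i))"
      using finI B by (simp add: S.emeasure_PiM_Collect)
    also have "(\<Prod>i\<in>I. emeasure ?O (B i)) = (\<Prod>i\<in>I. \<Prod>u\<in>K i. emeasure R (F (i # u)))"
      unfolding B_def using finK KF by (intro prod.cong) (simp_all add: O.emeasure_PiM_Collect)
    also have "\<dots> = (\<Prod>v\<in>J - {[]}. emeasure R (F v))"
      unfolding J_eq using finI finK
      by (subst prod.reindex) (auto simp: inj_on_def prod.Sigma case_prod_beta)
    \<comment> \<open>If the root is not in \<open>J\<close>, then \<open>A\<close> is the whole
      space and contributes the factor 1.\<close>
    also have "emeasure R A * \<dots> = (\<Prod>v\<in>J. emeasure R (F v))"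
      using J by (cases "[] \<in> J") (simp_all add: A_def R.emeasure_space_1 prod.remove[of J "[]"])
    finally show "emeasure (distr (R \<Otimes>\<^sub>M (\<Pi>\<^sub>M i\<in>UNIV. ?O)) ?O join_tree) ?E = (\<Prod>v\<in>J. emeasure R (F v))" .
  qed simp
qed

section \<open>Sums over vertices as integrals for the counting measure\<close>

text \<open>Makes monotone convergence, Tonelli and measurability of integrals available for
  \<open>W_star\<close>. Both sides are suprema of finite partial sums.\<close>

lemma infsum_eq_nn_integral_count_space:
  fixes f :: "'b :: countable \<Rightarrow> ennreal"
  shows "(\<Sum>\<^sub>\<infinity>x\<in>UNIV. f x) = (\<integral>\<^sup>+x. f x \<partial>count_space UNIV)"
proof (rule antisym)
  have le: "sum f F \<le> (\<integral>\<^sup>+x. f x \<partial>count_space UNIV)" if "finite F" for F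
  proof -
    have "sum f F = (\<integral>\<^sup>+x. f x \<partial>count_space F)"
      using that by (simp add: nn_integral_count_space_finite)
    also have "\<dots> = (\<integral>\<^sup>+x. f x * indicator F x \<partial>count_space UNIV)"
      by (cases "F = UNIV") (auto simp: nn_integral_count_space_indicator)
    also have "\<dots> \<le> (\<integral>\<^sup>+x. f x \<partial>count_space UNIV)"
      by (intro nn_integral_mono) (auto split: split_indicator)
    finally show ?thesis .
  qed
  have eq: "(\<Sum>\<^sub>\<infinity>x\<in>UNIV. f x) = (SUP F\<in>{F. finite F \<and> F \<subseteq> UNIV}. sum f F)"
    by (rule nonneg_infsum_complete) simp
  show "(\<Sum>\<^sub>\<infinity>x\<in>UNIV. f x) \<le> (\<integral>\<^sup>+x. f x \<partial>count_space UNIV)"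
    unfolding eq using le by (intro SUP_least) auto
  have "(\<integral>\<^sup>+x. f x \<partial>count_space UNIV) = (\<integral>\<^sup>+n. f (from_nat n) \<partial>count_space (range (to_nat :: 'b \<Rightarrow> nat)))"
    by (rule nn_integral_bij_count_space[symmetric])
       (auto simp: bij_betw_def inj_on_def surj_def image_iff intro: from_nat_to_nat[symmetric])
  \<comment> \<open>Extension by zero off the range of \<open>to_nat\<close>, which need not be all
    of the naturals.\<close>
  also have "\<dots> = (\<integral>\<^sup>+n. f (from_nat n) * indicator (range (to_nat :: 'b \<Rightarrow> nat)) n \<partial>count_space UNIV)"
    by (cases "range (to_nat :: 'b \<Rightarrow> nat) = UNIV") (auto simp: nn_integral_count_space_indicator)
  also have "\<dots> = (SUP n. \<Sum>i<n. f (from_nat i) * indicator (range (to_nat :: 'b \<Rightarrow> nat)) i)"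
    by (simp add: nn_integral_count_space_nat suminf_eq_SUP)
  also have "\<dots> \<le> (\<Sum>\<^sub>\<infinity>x\<in>UNIV. f x)"
    unfolding eq
  proof (rule SUP_mono)
    fix n :: nat
    let ?F = "from_nat ` ({..<n} \<inter> range (to_nat :: 'b \<Rightarrow> nat)) :: 'b set"
    have "(\<Sum>i<n. f (from_nat i) * indicator (range (to_nat :: 'b \<Rightarrow> nat)) i) =
        (\<Sum>i\<in>{..<n} \<inter> range (to_nat :: 'b \<Rightarrow> nat). f (from_nat i))"
      by (simp add: indicator_def if_distrib sum.If_cases)
    also have "\<dots> = sum f ?F"
      by (subst sum.reindex) (auto simp: inj_on_def)
    finally show "\<exists>F\<in>{F. finite F \<and> F \<subseteq> UNIV}.
        (\<Sum>i<n. f (from_nat i) * indicator (range (to_nat :: 'b \<Rightarrow> nat)) i) \<le> sum f F"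
      by (intro bexI[of _ ?F]) auto
  qed
  finally show "(\<integral>\<^sup>+x. f x \<partial>count_space UNIV) \<le> (\<Sum>\<^sub>\<infinity>x\<in>UNIV. f x)" .
qed

text \<open>The vertices other than the root correspond to pairs of a first letter and a remaining
  word; Tonelli then gives the iterated sum.\<close>

lemma nn_integral_count_space_nat_list:
  fixes f :: "nat list \<Rightarrow> ennreal"
  shows "(\<integral>\<^sup>+v. f v \<partial>count_space UNIV) = f [] + (\<Sum>i. \<integral>\<^sup>+u. f (i # u) \<partial>count_space UNIV)"
proof -
  have "(\<integral>\<^sup>+v. f v \<partial>count_space UNIV) =
      (\<integral>\<^sup>+v. f v * indicator {[]} v + f v * indicator (UNIV - {[]}) v \<partial>count_space UNIV)"
    by (intro nn_integral_cong) (auto split: split_indicator)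
  also have "\<dots> = (\<integral>\<^sup>+v. f v * indicator {[]} v \<partial>count_space UNIV) +
      (\<integral>\<^sup>+v. f v * indicator (UNIV - {[]}) v \<partial>count_space UNIV)"
    by (intro nn_integral_add) auto
  also have "(\<integral>\<^sup>+v. f v * indicator {[]} v \<partial>count_space UNIV) = f []"
    by (subst nn_integral_count_space_indicator[symmetric]) (auto simp: nn_integral_count_space_finite)
  also have "(\<integral>\<^sup>+v. f v * indicator (UNIV - {[]}) v \<partial>count_space UNIV) =
      (\<integral>\<^sup>+v. f v \<partial>count_space (UNIV - {[]}))"
    by (subst nn_integral_count_space_indicator[symmetric]) auto
  also have "\<dots> = (\<integral>\<^sup>+p. f (case p of (i, u) \<Rightarrow> i # u) \<partial>count_space UNIV)"
    by (rule nn_integral_bij_count_space[symmetric])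
       (auto simp: bij_betw_def inj_on_def image_iff, metis neq_Nil_conv)
  also have "\<dots> = (\<integral>\<^sup>+i. \<integral>\<^sup>+u. f (i # u) \<partial>count_space UNIV \<partial>count_space UNIV)"
    by (subst nn_integral_fst_count_space[symmetric]) simp
  also have "\<dots> = (\<Sum>i. \<integral>\<^sup>+u. f (i # u) \<partial>count_space UNIV)"
    by (rule nn_integral_count_space_nat)
  finally show ?thesis .
qed

lemma measurable_subtree:
  "(\<lambda>z u. z (i # u)) \<in> measurable (\<Pi>\<^sub>M v\<in>(UNIV :: nat list set). R) (\<Pi>\<^sub>M v\<in>(UNIV :: nat list set). R)"
  by (intro measurable_PiM_single' measurable_component_singleton) (auto simp: space_PiM PiE_iff)

text \<open>As \<open>Cons i\<close> is injective, the subtree at \<open>i\<close> has the law of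
  the whole tree, so almost sure properties are inherited.\<close>

lemma AE_subtree:
  assumes R: "prob_space R" and P: "AE z in (\<Pi>\<^sub>M v\<in>UNIV. R). P z"
  shows "AE z in (\<Pi>\<^sub>M v\<in>UNIV. R). P (\<lambda>u. z ((i :: nat) # u))"
proof -
  have "distr (\<Pi>\<^sub>M v\<in>UNIV. R) (\<Pi>\<^sub>M v\<in>UNIV. R) (\<lambda>z u. z (i # u)) = (\<Pi>\<^sub>M v\<in>UNIV. R)"
    using distr_PiM_reindex[of UNIV "\<lambda>_. R" "Cons i" UNIV] R by (simp add: restrict_UNIV)
  with P have "AE z in distr (\<Pi>\<^sub>M v\<in>UNIV. R) (\<Pi>\<^sub>M v\<in>UNIV. R) (\<lambda>z u. z (i # u)). P z"
    by (simp only:)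
  then show ?thesis by (rule AE_distrD[OF measurable_subtree])
qed

text \<open>The form of the branching property used in both directions: the values of
  \<open>G\<close> on the subtrees are i.i.d. and independent of the root mark. The map
  \<open>\<pi>\<close> extracts \<open>(C,T)\<close> from marks that may carry more data.\<close>

lemma distr_smoothing_sum_tree:
  assumes R: "prob_space R" and \<pi>: "\<pi> \<in> measurable R basic_space"
    and G: "G \<in> borel_measurable (\<Pi>\<^sub>M v\<in>UNIV. R)"
  shows "distr (\<Pi>\<^sub>M v\<in>UNIV. R) borel (\<lambda>z. smoothing_sum (\<pi> (z [])) (\<lambda>i. G (\<lambda>u. z (i # u)))) =
    smoothing_transform (distr R basic_space \<pi>) (distr (\<Pi>\<^sub>M v\<in>UNIV. R) borel G)"
    and "(\<lambda>z. smoothing_sum (\<pi> (z [])) (\<lambda>i. G (\<lambda>u. z (i # u)))) \<in> borel_measurable (\<Pi>\<^sub>M v\<in>UNIV. R)"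
proof -
  let ?O = "\<Pi>\<^sub>M v\<in>(UNIV :: nat list set). R"
  let ?B = "\<Pi>\<^sub>M i\<in>(UNIV :: nat set). borel :: real measure"
  let ?S = "\<lambda>z. smoothing_sum (\<pi> (z [])) (\<lambda>i. G (\<lambda>u. z (i # u)))"
  have O: "prob_space ?O" using R by (rule prob_space_PiM)
  have "?S = (\<lambda>z. case (\<pi> (z []), \<lambda>i. G (\<lambda>u. z (i # u))) of (ct, x) \<Rightarrow> smoothing_sum ct x)" by simp
  also have "\<dots> \<in> borel_measurable ?O"
  proof (rule measurable_compose[OF _ measurable_smoothing_sum], rule measurable_Pair)
    show "(\<lambda>z. \<pi> (z [])) \<in> measurable ?O basic_space"
      using \<pi> by measurable
    show "(\<lambda>z i. G (\<lambda>u. z (i # u))) \<in> measurable ?O ?B"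
      by (intro measurable_PiM_single' measurable_compose[OF measurable_subtree G]) auto
  qed
  finally show S: "?S \<in> borel_measurable ?O" .
  have mG: "(\<lambda>w i. G (w i)) \<in> measurable (\<Pi>\<^sub>M i\<in>(UNIV :: nat set). ?O) ?B"
    using G by (intro measurable_PiM_single') auto
  have PG: "prob_space (\<Pi>\<^sub>M i\<in>(UNIV :: nat set). distr ?O borel G)"
    by (intro prob_space_PiM prob_space.prob_space_distr[OF O G])
  have "distr R basic_space \<pi> \<Otimes>\<^sub>M (\<Pi>\<^sub>M i\<in>(UNIV :: nat set). distr ?O borel G) =
      distr (R \<Otimes>\<^sub>M (\<Pi>\<^sub>M i\<in>UNIV. ?O)) (basic_space \<Otimes>\<^sub>M ?B) (\<lambda>(r, w). (\<pi> r, \<lambda>i. G (w i)))"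
    unfolding distr_PiM_map[OF O G, symmetric]
    by (intro pair_measure_distr \<pi> mG)
       (simp add: distr_PiM_map[OF O G] PG prob_space_imp_sigma_finite)
  then have "smoothing_transform (distr R basic_space \<pi>) (distr ?O borel G) =
      distr (R \<Otimes>\<^sub>M (\<Pi>\<^sub>M i\<in>UNIV. ?O)) borel
        ((\<lambda>(ct, x). smoothing_sum ct x) \<circ> (\<lambda>(r, w). (\<pi> r, \<lambda>i. G (w i))))"
    unfolding smoothing_transform_def using \<pi> mG
    by (subst distr_distr[OF measurable_smoothing_sum, symmetric]) auto
  \<comment> \<open>The glued tree has root mark \<open>r\<close> and subtrees \<open>w i\<close>,
    so the law can be computed on the tree itself.\<close>
  also have "(\<lambda>(ct, x). smoothing_sum ct x) \<circ> (\<lambda>(r, w). (\<pi> r, \<lambda>i. G (w i))) = ?S \<circ> join_tree"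
    by (auto simp: fun_eq_iff)
  also have "distr (R \<Otimes>\<^sub>M (\<Pi>\<^sub>M i\<in>UNIV. ?O)) borel (?S \<circ> join_tree) = distr ?O borel ?S"
    by (subst distr_distr[OF S measurable_join_tree, symmetric]) (simp add: distr_join_tree[OF R])
  finally show "distr ?O borel ?S =
      smoothing_transform (distr R basic_space \<pi>) (distr ?O borel G)" ..
qed

section \<open>The tree sums in the canonical model: recursion, measurability and truncation\<close>

text \<open>The family \<open>z\<close> of marks is itself the sample point, i.e. this is the canonical model.\<close>

definition tree_sum :: "nat list set \<Rightarrow> (nat list \<Rightarrow> real \<times> (nat \<Rightarrow> real)) \<Rightarrow> ennreal" where
  "tree_sum A z = (\<integral>\<^sup>+v. ennreal (branch_weight (\<lambda>v i z. snd (z v) i) v z * fst (z v)) * indicator A v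
     \<partial>count_space UNIV)"

lemma branch_weight_cong:
  "(\<And>v i. S v i x = T v i y) \<Longrightarrow> branch_weight S v x = branch_weight T v y"
  by (induction v rule: rev_induct) simp_all

text \<open>Turns the recursion at the last letter into one at the first letter, as the
  decomposition at the root requires; hence the induction from the end of the word.\<close>

lemma branch_weight_Cons:
  "branch_weight (\<lambda>v i z. snd (z v) i) (i # v) z =
    snd (z []) i * branch_weight (\<lambda>v i z. snd (z v) i) v (\<lambda>u. z (i # u))"
proof (induction v rule: rev_induct)
  case Nil
  show ?case using branch_weight_snoc[of "\<lambda>v i z. snd (z v) i" "[]" i z] by simp
next
  case (snoc j v)
  then show ?case
    using branch_weight_snoc[of "\<lambda>v i z. snd (z v) i" "i # v" j z] by simp
qed

text \<open>A sample point enters \<open>W_star\<close> only through the marks it assigns to the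
  vertices.\<close>

lemma W_star_eq_tree_sum:
  "W_star Cv Tv \<omega> = tree_sum UNIV (\<lambda>v. basic_sequence (Cv v) (Tv v) \<omega>)"
  unfolding W_star_def tree_sum_def infsum_eq_nn_integral_count_space
  by (auto simp: basic_sequence_def intro!: nn_integral_cong arg_cong[where f = ennreal]
      arg_cong2[where f = "(*)"] branch_weight_cong)

text \<open>For \<open>A = UNIV\<close> this is the recursion of \<open>W_star\<close>; for the
  words shorter than \<open>Suc n\<close> it leads to the truncation at \<open>n\<close> in each
  subtree. Since \<open>ennreal\<close> sends negative numbers to 0, the sign of the weights matters
  when factoring out \<open>snd (z []) i\<close>.\<close>

lemma tree_sum_rec:
  assumes "\<And>v i. 0 \<le> snd (z v) i" and "[] \<in> A"
  shows "tree_sum A z = ennreal (fst (z [])) +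
    (\<Sum>i. ennreal (snd (z []) i) * tree_sum {u. i # u \<in> A} (\<lambda>u. z (i # u)))"
proof -
  have "ennreal (branch_weight (\<lambda>v i z. snd (z v) i) (i # u) z * fst (z (i # u))) * indicator A (i # u) =
    ennreal (snd (z []) i) * (ennreal (branch_weight (\<lambda>v i z. snd (z v) i) u (\<lambda>u. z (i # u)) *
      fst (z (i # u))) * indicator {u. i # u \<in> A} u)" for i u
    using assms(1) by (simp add: branch_weight_Cons ennreal_mult' mult.assoc indicator_def)
  then show ?thesis
    unfolding tree_sum_def using assms(2)
    by (subst nn_integral_count_space_nat_list) (simp add: nn_integral_cmult)
qed

lemma measurable_tree_sum [measurable]:
  "tree_sum A \<in> borel_measurable (\<Pi>\<^sub>M v\<in>UNIV. basic_space)"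
proof -
  let ?O = "\<Pi>\<^sub>M v\<in>(UNIV :: nat list set). basic_space"
  have T: "(\<lambda>z. snd (z v) i) \<in> borel_measurable ?O" for v i
    by (rule measurable_compose[OF _ measurable_component_singleton[of i UNIV]]) simp_all
  have L: "branch_weight (\<lambda>v i z. snd (z v) i) v \<in> borel_measurable ?O" for v
  proof (induction v rule: rev_induct)
    case (snoc i v)
    then show ?case using T by simp
  qed simp
  interpret sigma_finite_measure "count_space (UNIV :: nat list set)"
    by (rule sigma_finite_measure_count_space_countable) simp
  let ?f = "\<lambda>v z. ennreal (branch_weight (\<lambda>v i z. snd (z v) i) v z * fst (z v)) * indicator A v"
  have "(\<lambda>z. fst (z v)) \<in> borel_measurable ?O" for v
    by simp
  with L have f: "?f v \<in> borel_measurable ?O" for v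
    by measurable
  \<comment> \<open>Joint measurability in tree and vertex reduces to fixed vertices because there
    are countably many of them.\<close>
  have "(\<lambda>p. ?f (snd p) (fst p)) \<in> borel_measurable (?O \<Otimes>\<^sub>M count_space UNIV)"
    by (rule measurable_compose_countable[where f = "\<lambda>v p. ?f v (fst p)",
          OF measurable_compose[OF measurable_fst f] measurable_snd])
  then have "(\<lambda>(z, v). ?f v z) \<in> borel_measurable (?O \<Otimes>\<^sub>M count_space UNIV)"
    by (simp only: split_beta')
  then show ?thesis
    unfolding tree_sum_def[abs_def] by (rule borel_measurable_nn_integral)
qed

lemma incseq_tree_sum: "incseq (\<lambda>n. tree_sum {v. length v < n} z)"
  unfolding tree_sum_def
  by (intro incseq_SucI nn_integral_mono mult_left_mono) (auto simp: indicator_def)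

text \<open>Monotone convergence: a vertex \<open>v\<close> is counted from
  \<open>n = Suc (length v)\<close> on.\<close>

lemma SUP_tree_sum: "(SUP n. tree_sum {v. length v < n} z) = tree_sum UNIV z"
  unfolding tree_sum_def
proof (subst nn_integral_monotone_convergence_SUP[symmetric])
  let ?f = "\<lambda>v. ennreal (branch_weight (\<lambda>v i z. snd (z v) i) v z * fst (z v))"
  show "incseq (\<lambda>n v. ?f v * indicator {v. length v < n} v)"
    by (intro incseq_SucI le_funI mult_left_mono) (auto simp: indicator_def)
  have "(SUP n. ?f v * indicator {v. length v < n} v) = ?f v * indicator UNIV v" for v
  proof (rule antisym)
    show "?f v * indicator UNIV v \<le> (SUP n. ?f v * indicator {v. length v < n} v)"
      by (rule SUP_upper2[of "Suc (length v)"]) simp_all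
  qed (auto intro!: SUP_least simp: indicator_def)
  then show "(\<integral>\<^sup>+v. (SUP n. ?f v * indicator {v. length v < n} v) \<partial>count_space UNIV) =
      (\<integral>\<^sup>+v. ?f v * indicator UNIV v \<partial>count_space UNIV)" by simp
qed simp

lemma AE_tree_nonneg:
  assumes R: "prob_space R" and nonneg: "AE r in R. \<forall>i. 0 \<le> snd (f r) (i :: nat)"
  shows "AE z in (\<Pi>\<^sub>M v\<in>(UNIV :: nat list set). R). \<forall>v i. 0 \<le> snd (f (z v)) i"
  unfolding AE_all_countable
proof
  fix v :: "nat list"
  have "AE z in (\<Pi>\<^sub>M v\<in>(UNIV :: nat list set). R). \<forall>i. 0 \<le> snd (f (z v)) i"
    by (rule AE_PiM_component) (use assms in auto)
  then show "\<forall>i. AE z in (\<Pi>\<^sub>M v\<in>(UNIV :: nat list set). R). 0 \<le> snd (f (z v)) i"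
    by (simp add: AE_all_countable)
qed

section \<open>From almost sure finiteness to a fixed point\<close>

lemma fixed_point_if_tree_sum_finite:
  assumes Q: "prob_space Q" "sets Q = sets basic_space" "AE ct in Q. \<forall>i. 0 \<le> snd ct i"
    and finite: "AE z in (\<Pi>\<^sub>M v\<in>UNIV. Q). tree_sum UNIV z < \<infinity>"
  shows "distr (\<Pi>\<^sub>M v\<in>UNIV. Q) borel (\<lambda>z. enn2real (tree_sum UNIV z)) \<in> smoothing_fixed_points Q"
proof -
  let ?O = "\<Pi>\<^sub>M v\<in>(UNIV :: nat list set). Q"
  let ?G = "\<lambda>z. enn2real (tree_sum UNIV z)"
  have sets: "sets ?O = sets (\<Pi>\<^sub>M v\<in>(UNIV :: nat list set). basic_space)"
    using Q by (intro sets_PiM_cong) auto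
  interpret O: prob_space ?O using Q by (intro prob_space_PiM)
  have G: "?G \<in> borel_measurable ?O"
  proof -
    have "tree_sum UNIV \<in> borel_measurable ?O"
      unfolding measurable_cong_sets[OF sets refl] by (rule measurable_tree_sum)
    then show ?thesis by simp
  qed
  interpret P: prob_space "distr ?O borel ?G" by (rule O.prob_space_distr[OF G])
  have id: "(\<lambda>x. x) \<in> measurable Q basic_space"
    by (rule measurable_ident_sets[OF Q(2)])
  note S = distr_smoothing_sum_tree[OF Q(1) id G]
  have "AE z in ?O. ennreal (?G z) = smoothing_sum (z []) (\<lambda>i. ?G (\<lambda>u. z (i # u)))"
  proof -
    \<comment> \<open>Finiteness in all of the countably many subtrees at once lets
      \<open>enn2real\<close> be undone inside the recursion.\<close>
    have fin: "AE z in ?O. \<forall>i. tree_sum UNIV (\<lambda>u. z (i # u)) < \<infinity>"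
      using AE_subtree[OF Q(1) finite] by (simp add: AE_all_countable)
    show ?thesis
      using AE_tree_nonneg[of Q "\<lambda>x. x", OF Q(1,3)] finite fin
    proof eventually_elim
      case (elim z)
      have "ennreal (?G z) = tree_sum UNIV z" using elim by simp
      also have "\<dots> = ennreal (fst (z [])) +
          (\<Sum>i. ennreal (snd (z []) i) * tree_sum UNIV (\<lambda>u. z (i # u)))"
        using elim by (subst tree_sum_rec) auto
      also have "\<dots> = smoothing_sum (z []) (\<lambda>i. ?G (\<lambda>u. z (i # u)))"
        unfolding smoothing_sum_def using elim by (simp add: ennreal_mult)
      finally show ?case .
    qed
  qed
  then have "distr ?O borel (\<lambda>z. ennreal (?G z)) =
      distr ?O borel (\<lambda>z. smoothing_sum (z []) (\<lambda>i. ?G (\<lambda>u. z (i # u))))"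
    using S(2) G by (intro distr_cong_AE) auto
  also have "\<dots> = smoothing_transform Q (distr ?O borel ?G)"
    unfolding S(1) using Q(2) by (simp add: distr_id2)
  also have "distr ?O borel (\<lambda>z. ennreal (?G z)) = distr (distr ?O borel ?G) borel ennreal"
    using G by (subst distr_distr) (auto simp: o_def)
  finally show ?thesis
    using G P.prob_space_axioms
    by (auto simp: smoothing_fixed_points_def AE_distr_iff real_distribution_def
        real_distribution_axioms_def)
qed

section \<open>From a fixed point to almost sure finiteness\<close>

text \<open>A vertex \<open>v\<close> is marked with \<open>((C(v), T(v)), X\<^sub>v)\<close>, and \<open>smoothing_iterate n\<close> is \<open>Y\<^sub>n\<close>. It is real-valued
  because \<open>enn2real\<close> sends \<open>\<infinity>\<close> to \<open>0\<close>; for a fixed point \<open>P\<close> this changes \<open>Y\<^sub>n\<close> on a null set only.\<close>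

primrec smoothing_iterate ::
    "nat \<Rightarrow> (nat list \<Rightarrow> (real \<times> (nat \<Rightarrow> real)) \<times> real) \<Rightarrow> real" where
  "smoothing_iterate 0 = (\<lambda>z. snd (z []))"
| "smoothing_iterate (Suc n) = (\<lambda>z. enn2real
     (smoothing_sum (fst (z [])) (\<lambda>i. smoothing_iterate n (\<lambda>u. z (i # u)))))"

lemma tree_sum_finite_if_fixed_point:
  assumes Q: "prob_space Q" "sets Q = sets basic_space" "AE ct in Q. \<forall>i. 0 \<le> snd ct i"
    and P: "P \<in> smoothing_fixed_points Q"
  shows "AE z in (\<Pi>\<^sub>M v\<in>UNIV. Q). tree_sum UNIV z < \<infinity>"
proof -
  interpret Q: prob_space Q by fact
  interpret P: real_distribution P using P by (simp add: smoothing_fixed_points_def)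
  have P_nonneg: "AE x in P. 0 \<le> x" and P_fix: "distr P borel ennreal = smoothing_transform Q P"
    using P by (auto simp: smoothing_fixed_points_def)
  interpret QP: pair_prob_space Q P ..
  let ?R = "Q \<Otimes>\<^sub>M P"
  let ?O = "\<Pi>\<^sub>M v\<in>(UNIV :: nat list set). ?R"
  let ?B = "\<Pi>\<^sub>M v\<in>(UNIV :: nat list set). basic_space"
  have R: "prob_space ?R" by (rule prob_space_pair) unfold_locales
  interpret O: prob_space ?O by (intro prob_space_PiM R)
  have sets_B: "sets (\<Pi>\<^sub>M v\<in>(UNIV :: nat list set). Q) = sets ?B"
    using Q by (intro sets_PiM_cong) auto
  have fst: "fst \<in> measurable ?R basic_space"
    using measurable_cong_sets[OF refl Q(2)] measurable_fst by blast
  have snd: "snd \<in> borel_measurable ?R"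
    using measurable_cong_sets[OF refl P.events_eq_borel] measurable_snd by blast
  have distr_fst: "distr ?R basic_space fst = Q"
  proof -
    have "distr ?R basic_space fst = distr ?R Q fst" using Q(2) by (intro distr_cong) auto
    then show ?thesis using P.distr_pair_fst[of Q] by simp
  qed
  have distr_snd: "distr ?R borel snd = P"
  proof (rule measure_eqI)
    fix A assume A: "A \<in> sets (distr ?R borel snd)"
    then have "snd -` A \<inter> space ?R = space Q \<times> A" by (auto simp: space_pair_measure)
    with A show "emeasure (distr ?R borel snd) A = emeasure P A"
      using snd by (simp add: emeasure_distr P.emeasure_pair_measure_Times Q.emeasure_space_1)
  qed simp
  have R_nonneg: "AE r in ?R. \<forall>i. 0 \<le> snd (fst r) i"
  proof (rule AE_distrD[OF fst])
    show "AE ct in distr ?R basic_space fst. \<forall>i. 0 \<le> snd ct i"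
      unfolding distr_fst by (rule Q(3))
  qed
  let ?Y = smoothing_iterate
  let ?S = "\<lambda>n z. smoothing_sum (fst (z [])) (\<lambda>i. ?Y n (\<lambda>u. z (i # u)))"
  \<comment> \<open>One smoothing step applied to subtree values of law \<open>P\<close>: the
    fixed-point equation returns the image of \<open>P\<close> under \<open>ennreal\<close>.\<close>
  have S_law: "distr ?O borel (?S n) = distr P borel ennreal"
    if "?Y n \<in> borel_measurable ?O" "distr ?O borel (?Y n) = P" for n
    using distr_smoothing_sum_tree(1)[OF R fst that(1)] unfolding that(2) distr_fst P_fix .
  have "?Y n \<in> borel_measurable ?O \<and> distr ?O borel (?Y n) = P" for n
  proof (induction n)
    case 0
    have "distr ?O borel (\<lambda>z. snd (z [])) = distr (distr ?O ?R (\<lambda>z. z [])) borel snd"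
      using snd by (subst distr_distr) (auto simp: o_def)
    also have "distr ?O ?R (\<lambda>z. z []) = ?R"
      using R by (intro distr_PiM_component) auto
    finally show ?case using snd distr_snd by simp
  next
    case (Suc n)
    note S = distr_smoothing_sum_tree(2)[OF R fst conjunct1[OF Suc]]
    have "distr ?O borel (\<lambda>z. enn2real (?S n z)) = distr (distr ?O borel (?S n)) borel enn2real"
      using S by (subst distr_distr) (auto simp: o_def)
    also have "\<dots> = distr P borel (\<lambda>x. enn2real (ennreal x))"
      unfolding S_law[OF conjunct1[OF Suc] conjunct2[OF Suc]]
      by (subst distr_distr) (auto simp: o_def)
    \<comment> \<open>The round trip through \<open>ennreal\<close> fixes nonnegative reals, and
      \<open>P\<close> is concentrated on these.\<close>
    also have "\<dots> = distr P borel (\<lambda>x. x)"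
      using P_nonneg by (intro distr_cong_AE) auto
    finally show ?case using S by (simp add: distr_id2)
  qed
  then have Y: "?Y n \<in> borel_measurable ?O" and Y_law: "distr ?O borel (?Y n) = P" for n
    by blast+
  \<comment> \<open>The law of \<open>?S n\<close> is an image under \<open>ennreal\<close>, hence
    gives no mass to infinity, and \<open>enn2real\<close> loses nothing almost surely.\<close>
  have S_finite: "AE z in ?O. ?S n z < \<infinity>" for n
  proof (rule AE_distrD[OF distr_smoothing_sum_tree(2)[OF R fst Y]])
    show "AE x in distr ?O borel (?S n). x < \<infinity>"
      unfolding S_law[OF Y Y_law] by (subst AE_distr_iff) auto
  qed
  \<comment> \<open>Generations strictly below \<open>n\<close>, so \<open>?W 0\<close> is an empty
    sum and the induction starts trivially.\<close>
  let ?W = "\<lambda>n z. tree_sum {v. length v < n} (\<lambda>v. fst (z v))"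
  have W_le: "AE z in ?O. ?W n z \<le> ennreal (?Y n z)" for n
  proof (induction n)
    case 0
    show ?case by (simp add: tree_sum_def)
  next
    case (Suc n)
    have "AE z in ?O. \<forall>i. ?W n (\<lambda>u. z (i # u)) \<le> ennreal (?Y n (\<lambda>u. z (i # u)))"
      using AE_subtree[OF R Suc] by (simp add: AE_all_countable)
    with AE_tree_nonneg[OF R R_nonneg] S_finite[of n] show ?case
    proof eventually_elim
      case (elim z)
      have "?W (Suc n) z = ennreal (fst (fst (z []))) +
          (\<Sum>i. ennreal (snd (fst (z [])) i) * ?W n (\<lambda>u. z (i # u)))"
        using elim by (subst tree_sum_rec) auto
      also have "\<dots> \<le> ennreal (fst (fst (z []))) +
          (\<Sum>i. ennreal (snd (fst (z [])) i) * ennreal (?Y n (\<lambda>u. z (i # u))))"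
        using elim by (intro add_left_mono suminf_le mult_left_mono) auto
      also have "\<dots> = ?S n z"
        using elim by (simp add: smoothing_sum_def ennreal_mult')
      finally show ?case using elim by simp
    qed
  qed
  have m: "(\<lambda>z v. fst (z v)) \<in> measurable ?O ?B"
    using fst by (intro measurable_PiM_single') (auto simp: space_PiM PiE_iff space_pair_measure)
  have W: "(\<lambda>z. tree_sum A (\<lambda>v. fst (z v))) \<in> borel_measurable ?O" for A
    by (rule measurable_compose[OF m measurable_tree_sum])
  let ?W' = "\<lambda>z. tree_sum UNIV (\<lambda>v. fst (z v))"
  \<comment> \<open>An infinite total forces some truncation above \<open>k\<close>. These events
    increase with \<open>n\<close>, and each is bounded by the probability of
    \<open>?Y n > k\<close>, which does not depend on \<open>n\<close>.\<close>
  have tail: "emeasure ?O {z \<in> space ?O. ?W' z = \<infinity>} \<le> emeasure P {real k<..}" for k :: nat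
  proof -
    have "{z \<in> space ?O. ?W' z = \<infinity>} \<subseteq> (\<Union>n. {z \<in> space ?O. ennreal (real k) < ?W n z})"
      by (auto simp: SUP_tree_sum[symmetric] less_SUP_iff[symmetric] simp del: SUP_eq_top_iff)
    then have "emeasure ?O {z \<in> space ?O. ?W' z = \<infinity>} \<le>
        emeasure ?O (\<Union>n. {z \<in> space ?O. ennreal (real k) < ?W n z})"
      using W by (intro emeasure_mono sets.countable_UN image_subsetI) simp_all
    also have "\<dots> = (SUP n. emeasure ?O {z \<in> space ?O. ennreal (real k) < ?W n z})"
    proof (rule SUP_emeasure_incseq[symmetric])
      show "incseq (\<lambda>n. {z \<in> space ?O. ennreal (real k) < ?W n z})"
        using incseq_tree_sum by (fastforce simp: incseq_def intro: less_le_trans)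
    qed (use W in auto)
    also have "\<dots> \<le> emeasure P {real k<..}"
    proof (rule SUP_least)
      fix n
      have "emeasure ?O {z \<in> space ?O. ennreal (real k) < ?W n z} \<le>
          emeasure ?O (?Y n -` {real k<..} \<inter> space ?O)"
      proof (rule emeasure_mono_AE)
        show "AE z in ?O. z \<in> {z \<in> space ?O. ennreal (real k) < ?W n z} \<longrightarrow>
            z \<in> ?Y n -` {real k<..} \<inter> space ?O"
          using W_le[of n]
        proof eventually_elim
          case (elim z)
          have "real k < ?Y n z" if "ennreal (real k) < ?W n z"
            using less_le_trans[OF that elim] by (simp add: ennreal_less_iff)
          then show ?case by auto
        qed
      qed (use Y in measurable)
      also have "\<dots> = emeasure P {real k<..}"
        using Y by (subst Y_law[of n, symmetric]) (simp add: emeasure_distr)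
      finally show "emeasure ?O {z \<in> space ?O. ennreal (real k) < ?W n z} \<le> emeasure P {real k<..}" .
    qed
    finally show ?thesis .
  qed
  \<comment> \<open>Continuity from above: the tails of the law \<open>P\<close> on the reals
    vanish.\<close>
  have "(\<lambda>k. emeasure P {real k<..}) \<longlonglongrightarrow> emeasure P (\<Inter>k. {real k<..})"
    by (rule Lim_emeasure_decseq) (auto simp: decseq_def)
  moreover have "(\<Inter>k. {real k<..}) = {}"
    by (auto simp: not_le[symmetric]) (meson real_arch_simple)
  ultimately have "(\<lambda>k. emeasure P {real k<..}) \<longlonglongrightarrow> 0" by simp
  then have "emeasure ?O {z \<in> space ?O. ?W' z = \<infinity>} \<le> 0"
    by (rule LIMSEQ_le_const) (use tail in auto)
  then have "AE z in ?O. ?W' z < \<infinity>"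
    using W[of UNIV] by (subst AE_iff_measurable[OF _ refl]) (auto simp: less_top[symmetric])
  \<comment> \<open>Forgetting the marks \<open>X_v\<close> maps the enlarged model onto the product
    of copies of \<open>Q\<close>.\<close>
  then have "AE z in distr ?O ?B (\<lambda>z v. fst (z v)). tree_sum UNIV z < \<infinity>"
    using m by (subst AE_distr_iff) auto
  then show ?thesis
    unfolding distr_PiM_map[OF R fst] distr_fst .
qed

section \<open>Transfer from an arbitrary model to the canonical one\<close>

theorem theorem3p1:
  fixes M :: "'a measure"
    and C :: "'a \<Rightarrow> real" and T :: "nat \<Rightarrow> 'a \<Rightarrow> real"
    and Cv :: "nat list \<Rightarrow> 'a \<Rightarrow> real" and Tv :: "nat list \<Rightarrow> nat \<Rightarrow> 'a \<Rightarrow> real"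
  assumes "prob_space M"
    and "C \<in> borel_measurable M" and "\<And>i. T i \<in> borel_measurable M"
    and "\<And>\<omega>. \<omega> \<in> space M \<Longrightarrow> 0 \<le> C \<omega>"
    and "\<And>i \<omega>. \<omega> \<in> space M \<Longrightarrow> 0 \<le> T i \<omega>"
    and root: "Cv [] = C" "Tv [] = T"
    and independent: "prob_space.indep_vars M (\<lambda>_. basic_space)
          (\<lambda>v. basic_sequence (Cv v) (Tv v)) UNIV"
    and identically_distributed: "\<And>v. distr M basic_space (basic_sequence (Cv v) (Tv v)) =
          distr M basic_space (basic_sequence C T)"
  shows "smoothing_fixed_points (distr M basic_space (basic_sequence C T)) \<noteq> {} \<longleftrightarrow>
         (AE \<omega> in M. W_star Cv Tv \<omega> < \<infinity>)"
proof -
  interpret prob_space M by fact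
  let ?Q = "distr M basic_space (basic_sequence C T)"
  let ?B = "\<Pi>\<^sub>M v\<in>(UNIV :: nat list set). basic_space"
  let ?Z = "\<lambda>\<omega> v. basic_sequence (Cv v) (Tv v) \<omega>"
  have rv: "basic_sequence (Cv v) (Tv v) \<in> measurable M basic_space" for v
    using independent by (auto simp: indep_vars_def)
  from rv[of "[]"] have CT: "basic_sequence C T \<in> measurable M basic_space"
    by (simp add: root)
  have Q: "prob_space ?Q" "sets ?Q = sets basic_space"
    using CT by (auto intro: prob_space_distr)
  \<comment> \<open>\<open>?Q\<close> lives on a space that also contains negative sequences, so
    pointwise nonnegativity on \<open>M\<close> becomes an almost sure statement.\<close>
  have Q_nonneg: "AE ct in ?Q. \<forall>i. 0 \<le> snd ct i"
    unfolding AE_all_countable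
  proof
    fix i
    have "(\<lambda>ct. snd ct i) \<in> borel_measurable basic_space"
      by (rule measurable_compose[OF _ measurable_component_singleton[of i UNIV]]) simp_all
    then show "AE ct in ?Q. 0 \<le> snd ct i"
      using CT assms(5) by (subst AE_distr_iff) (auto simp: basic_sequence_def)
  qed
  have Z: "?Z \<in> measurable M ?B"
    using rv by (intro measurable_PiM_single') (auto dest: measurable_space simp: Pi_iff)
  \<comment> \<open>Independence and equal laws together say that the whole family of marks has the
    product law, which is the canonical model.\<close>
  have law: "distr M ?B ?Z = (\<Pi>\<^sub>M v\<in>UNIV. ?Q)"
    using indep_vars_iff_distr_eq_PiM[where I = UNIV and M' = "\<lambda>_. basic_space"
        and X = "\<lambda>v. basic_sequence (Cv v) (Tv v)"]
      independent rv by (simp add: restrict_UNIV identically_distributed)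
  have "(AE \<omega> in M. W_star Cv Tv \<omega> < \<infinity>) \<longleftrightarrow> (AE z in distr M ?B ?Z. tree_sum UNIV z < \<infinity>)"
    unfolding W_star_eq_tree_sum using Z by (subst AE_distr_iff) auto
  then show ?thesis
    unfolding law
    using fixed_point_if_tree_sum_finite[OF Q Q_nonneg] tree_sum_finite_if_fixed_point[OF Q Q_nonneg]
    by auto
qed

end
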